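(* Fix an integer $r>0$ and let $n=(10\,\ell\log\ell)^{r+1}$, $p=\frac{3}{10}(10\,\ell\log\ell)^{-r}$. Then with high probability, every $r$-ball in $G_{n,p}$ is $4$-degenerate.
   Context: Graphs are finite, simple and undirected. $G_{n,p}$ is the Erdős–Rényi random graph on $n$ labelled vertices in which each edge is included independently with probability $p$; non-integral $n$ is to be rounded down to an integer. "With high probability" means with probability tending to $1$ as $\ell\to\infty$ ($\ell$ a positive integer). For a graph $G=(V,E)$ and $v\in V$, the $r$-ball $U_r(v,G)$ around $v$ is the subgraph of $G$ induced on all vertices at graph distance at most $r$ from $v$. A graph is $k$-degenerate if the minimum degree of every subgraph of it is at most $k$. $\log$ is the natural logarithm. *)

theory Defs
  imports "HOL-Probability.Probability" "HOL-Library.Extended_Nat"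
begin

record 'a ugraph =
  verts :: "'a set"
  edges :: "'a set set"

definition all_edges :: "'a set \<Rightarrow> 'a set set" where
  "all_edges V = {e. e \<subseteq> V \<and> card e = 2}"

definition wf_ugraph :: "'a ugraph \<Rightarrow> bool" where
  "wf_ugraph G \<longleftrightarrow> finite (verts G) \<and> edges G \<subseteq> all_edges (verts G)"

definition is_subgraph :: "'a ugraph \<Rightarrow> 'a ugraph \<Rightarrow> bool" where
  "is_subgraph H G \<longleftrightarrow> wf_ugraph H \<and> verts H \<subseteq> verts G \<and> edges H \<subseteq> edges G"

definition induced_on :: "'a ugraph \<Rightarrow> 'a set \<Rightarrow> 'a ugraph" where
  "induced_on G W = \<lparr>verts = verts G \<inter> W, edges = {e \<in> edges G. e \<subseteq> W}\<rparr>"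

definition degree :: "'a ugraph \<Rightarrow> 'a \<Rightarrow> nat" where
  "degree G v = card {e \<in> edges G. v \<in> e}"

definition min_degree :: "'a ugraph \<Rightarrow> nat" where
  "min_degree G = Min (degree G ` verts G)"

text \<open>The minimum degree is meaningful for nonempty vertex sets only, hence the restriction
  to subgraphs with at least one vertex. The graph without vertices is \<open>k\<close>-degenerate
  for every \<open>k\<close>.\<close>

definition degenerate :: "nat \<Rightarrow> 'a ugraph \<Rightarrow> bool" where
  "degenerate k G \<longleftrightarrow> (\<forall>H. is_subgraph H G \<and> verts H \<noteq> {} \<longrightarrow> min_degree H \<le> k)"

text \<open>A walk is given by the nonempty list of its vertices, so its number of edges is one less
  than the length of the list.\<close>

definition is_walk :: "'a ugraph \<Rightarrow> 'a \<Rightarrow> 'a list \<Rightarrow> 'a \<Rightarrow> bool" where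
  "is_walk G u w v \<longleftrightarrow> w \<noteq> [] \<and> hd w = u \<and> last w = v \<and> set w \<subseteq> verts G \<and>
     successively (\<lambda>x y. {x, y} \<in> edges G) w"

text \<open>Vertices in different components have distance \<open>\<infinity>\<close>, the infimum of the empty set.\<close>

definition graph_dist :: "'a ugraph \<Rightarrow> 'a \<Rightarrow> 'a \<Rightarrow> enat" where
  "graph_dist G u v = (INF w \<in> {w. is_walk G u w v}. enat (length w - 1))"

definition r_ball :: "nat \<Rightarrow> 'a \<Rightarrow> 'a ugraph \<Rightarrow> 'a ugraph" where
  "r_ball r v G = induced_on G {u \<in> verts G. graph_dist G v u \<le> enat r}"

text \<open>\<^const>\<open>Pi_pmf\<close> is the product distribution: independent coin flips with success
  probability \<open>p\<close>, one for every pair of vertices. The value \<^term>\<open>False\<close> is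
  only the default outside of the index set.\<close>

definition gnp :: "nat \<Rightarrow> real \<Rightarrow> nat ugraph pmf" where
  "gnp n p = map_pmf (\<lambda>f. \<lparr>verts = {..<n}, edges = {e \<in> all_edges {..<n}. f e}\<rparr>)
     (Pi_pmf (all_edges {..<n}) False (\<lambda>_. bernoulli_pmf p))"

end

theory Submission
  imports Defs "HOL-Real_Asymp.Real_Asymp"
begin

text \<open>Write \<open>d = 10 * l * ln l\<close>, so that \<open>n \<approx> d ^ (r + 1)\<close> and \<open>p = 3/10 * d ^ (-r)\<close>. Degrees are about
  \<open>3/10 * d\<close>, and by a first moment bound (\<open>prob_degree_ge\<close>) all of them are at most \<open>d\<close> with high
  probability. Hence every \<open>r\<close>-ball has at most \<open>M = 10/7 * d ^ r\<close> vertices, and \<open>M * p < 1/2\<close>: apart from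
  the edges of a spanning tree, a ball looks like a random graph of small constant average degree.

  If a ball is not 4-degenerate, it contains a subgraph of minimum degree at least 5 on a set \<open>S\<close> of
  \<open>k \<ge> 6\<close> vertices. This subgraph has at least \<open>5k/2\<close> edges, at most \<open>k\<close> of which join a vertex to its parent
  in a search tree of the ball. So there are at least \<open>3k/2\<close> excess edges inside \<open>S\<close>, and the ball
  stays the same when they are removed (\<open>not_degenerate_imp_excess_edges\<close>). Comparing a graph with
  the one without the excess edges (\<open>prob_remove\<close>) shows that each excess edge costs a factor
  \<open>q = p / (1 - p)\<close>, as if the ball had been fixed in advance. The union bound over \<open>S\<close> and the
  excess edges is, for a fixed centre,
  \<open>(M choose k) * ((k choose 2) choose (3k/2)) * q ^ (3k/2) \<le> (7/5 * k * q) ^ (k/2)\<close>,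
  where \<open>3k/2\<close> on the left is rounded up.
  As \<open>k \<ge> 6\<close> and \<open>k * q \<le> 1/2\<close>, the sum over \<open>k\<close> is \<open>O(q ^ 3)\<close>, and the \<open>n\<close> possible centres contribute
  \<open>O(n * q ^ 3) = O(d ^ (1 - 2 * r))\<close>, which tends to 0.\<close>

section \<open>Balls and parent edges\<close>

text \<open>The ball around \<open>v\<close>, grown one step at a time directly from an edge set, without mentioning
  walks. Each step adds endpoints of edges only, so no vertex set is needed.\<close>

primrec nball :: "'a set set \<Rightarrow> nat \<Rightarrow> 'a \<Rightarrow> 'a set" where
  "nball E 0 v = {v}"
| "nball E (Suc i) v = insert v (\<Union>x\<in>nball E i v. {u. {x, u} \<in> E})"

lemma nball_mono_Suc: "nball E i v \<subseteq> nball E (Suc i) v"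
  by (induction i) auto

lemma nball_mono: "i \<le> j \<Longrightarrow> nball E i v \<subseteq> nball E j v"
  using lift_Suc_mono_le[of "\<lambda>i. nball E i v", OF nball_mono_Suc] by blast

lemma nball_mono_edges: "E' \<subseteq> E \<Longrightarrow> nball E' i v \<subseteq> nball E i v"
  by (induction i) auto

lemma nball_subset_verts:
  assumes "E \<subseteq> all_edges V" "v \<in> V"
  shows "nball E i v \<subseteq> V"
  using assms by (cases i) (auto simp: all_edges_def)

lemma last_walk_in_nball:
  assumes "successively (\<lambda>x y. {x, y} \<in> E) w" "w \<noteq> []" "hd w = v"
  shows "last w \<in> nball E (length w - 1) v"
  using assms
proof (induction w rule: rev_induct)
  case (snoc x xs)
  show ?case
  proof (cases "xs = []")
    case False
    with snoc have "last xs \<in> nball E (length xs - 1) v" "{last xs, x} \<in> E"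
      by (auto simp: successively_append_iff)
    with False show ?thesis by (cases "length xs") auto
  qed (use snoc in auto)
qed auto

lemma graph_dist_le_imp_nball:
  assumes "graph_dist G v u \<le> enat r"
  shows "u \<in> nball (edges G) r v"
proof -
  let ?W = "{w. is_walk G v w u}"
  have "?W \<noteq> {}"
  proof
    assume "?W = {}"
    then have "graph_dist G v u = top" by (simp only: graph_dist_def) simp
    with assms show False by (simp add: top_enat_def)
  qed
  then have "graph_dist G v u \<in> (\<lambda>w. enat (length w - 1)) ` ?W"
    unfolding graph_dist_def by (meson ex_in_conv imageI wellorder_InfI)
  then obtain w where "is_walk G v w u" "length w - 1 \<le> r" using assms by auto
  then show ?thesis
    using last_walk_in_nball[of "edges G" w v] nball_mono[of "length w - 1" r "edges G" v]
    by (auto simp: is_walk_def)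
qed

text \<open>Every vertex \<open>u \<noteq> v\<close> of the ball picks a parent \<open>par u\<close> one level closer to \<open>v\<close>.
  The edges \<open>{par u, u}\<close> alone already produce the whole ball. Sending \<open>u\<close> to its parent edge
  shows that at most \<open>card S\<close> of them lie inside \<open>S\<close>, which is all that is needed of the fact that
  they form a forest.\<close>

lemma ex_parent_edges:
  fixes E :: "'a set set"
  shows "\<exists>T\<subseteq>E. (\<forall>E'. T \<subseteq> E' \<and> E' \<subseteq> E \<longrightarrow> nball E' r v = nball E r v) \<and>
     (\<forall>S. finite S \<longrightarrow> card {e \<in> T. e \<subseteq> S} \<le> card S)"
proof -
  define lev where "lev u = (LEAST i. u \<in> nball E i v)" for u
  have "\<exists>x. {x, u} \<in> E \<and> x \<in> nball E (lev u - 1) v \<and> 0 < lev u" if "u \<in> nball E r v" "u \<noteq> v" for u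
  proof -
    have "u \<in> nball E (lev u) v" unfolding lev_def using that(1) by (rule LeastI)
    then show ?thesis using that(2) by (cases "lev u") auto
  qed
  then have "\<forall>u\<in>nball E r v - {v}. \<exists>x. {x, u} \<in> E \<and> x \<in> nball E (lev u - 1) v \<and> 0 < lev u"
    by blast
  from bchoice[OF this] obtain par where
    "\<forall>u\<in>nball E r v - {v}. {par u, u} \<in> E \<and> par u \<in> nball E (lev u - 1) v \<and> 0 < lev u" ..
  then have par: "{par u, u} \<in> E" "par u \<in> nball E (lev u - 1) v" "0 < lev u"
    if "u \<in> nball E r v" "u \<noteq> v" for u
    using that by simp_all
  define T where "T = (\<lambda>u. {par u, u}) ` (nball E r v - {v})"
  have "nball E i v \<subseteq> nball E' i v" if "T \<subseteq> E'" "i \<le> r" for E' i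
    using that(2)
  proof (induction i)
    case (Suc i)
    show ?case
    proof (rule subsetI)
      fix u assume u: "u \<in> nball E (Suc i) v"
      show "u \<in> nball E' (Suc i) v"
      proof (cases "u = v")
        case False
        have ur: "u \<in> nball E r v" using u nball_mono[OF Suc.prems, of E v] by (rule rev_subsetD)
        have "lev u \<le> Suc i" unfolding lev_def using u by (rule Least_le)
        then have "lev u - 1 \<le> i" by simp
        then have "par u \<in> nball E i v"
          by (rule subsetD[OF nball_mono par(2)[OF ur False]])
        then have "par u \<in> nball E' i v" using Suc.IH Suc.prems by auto
        moreover have "{par u, u} \<in> E'" using ur False \<open>T \<subseteq> E'\<close> by (auto simp: T_def)
        ultimately show ?thesis by auto
      qed auto
    qed
  qed auto
  then have "\<forall>E'. T \<subseteq> E' \<and> E' \<subseteq> E \<longrightarrow> nball E' r v = nball E r v"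
    by (simp add: nball_mono_edges subset_antisym)
  moreover have "card {e \<in> T. e \<subseteq> S} \<le> card S" if "finite S" for S
  proof -
    have "{e \<in> T. e \<subseteq> S} \<subseteq> (\<lambda>u. {par u, u}) ` S" by (auto simp: T_def)
    then show ?thesis using that by (meson card_image_le card_mono finite_imageI le_trans)
  qed
  moreover have "T \<subseteq> E" using par by (auto simp: T_def)
  ultimately show ?thesis by blast
qed

lemma card_nball_le:
  assumes "finite V" "E \<subseteq> all_edges V" "v \<in> V" "\<And>x. x \<in> V \<Longrightarrow> card {u. {x, u} \<in> E} \<le> \<Delta>"
  shows "card (nball E i v) \<le> (\<Sum>j\<le>i. \<Delta> ^ j)"
proof (induction i)
  case (Suc i)
  have sub: "nball E i v \<subseteq> V" using nball_subset_verts[OF assms(2,3)] .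
  then have fin: "finite (nball E i v)" using assms(1) finite_subset by blast
  have "card (nball E (Suc i) v) \<le> Suc (card (\<Union>x\<in>nball E i v. {u. {x, u} \<in> E}))"
    by (simp add: card_insert_le_m1)
  also have "card (\<Union>x\<in>nball E i v. {u. {x, u} \<in> E}) \<le> (\<Sum>x\<in>nball E i v. card {u. {x, u} \<in> E})"
    using fin by (rule card_UN_le)
  also have "\<dots> \<le> (\<Sum>x\<in>nball E i v. \<Delta>)" using sub assms(4) by (intro sum_mono) auto
  also have "\<dots> \<le> \<Delta> * (\<Sum>j\<le>i. \<Delta> ^ j)" using Suc by simp
  also have "Suc \<dots> = (\<Sum>j\<le>Suc i. \<Delta> ^ j)"
    by (subst sum.atMost_Suc_shift) (simp add: sum_distrib_left)
  finally show ?case by simp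
qed auto

section \<open>Dense subgraphs\<close>

lemma finite_all_edges: "finite V \<Longrightarrow> finite (all_edges V)"
  by (auto simp: all_edges_def)

lemma card_all_edges: "finite V \<Longrightarrow> card (all_edges V) = card V choose 2"
  by (simp add: all_edges_def n_subsets)

lemma sum_degree:
  assumes "wf_ugraph H"
  shows "(\<Sum>v\<in>verts H. degree H v) = 2 * card (edges H)"
proof -
  have "{i \<in> verts H. i \<in> e} = e" "card e = 2" if "e \<in> edges H" for e
    using that assms by (auto simp: wf_ugraph_def all_edges_def)
  moreover have "finite (verts H)" "finite (edges H)"
    using assms by (auto simp: wf_ugraph_def intro: finite_subset finite_all_edges)
  ultimately show ?thesis unfolding degree_def
    by (subst sum_multicount_gen[where k = "\<lambda>_. 2"]) auto
qed

text \<open>A subgraph of the ball with minimum degree at least 5 on a vertex set \<open>S\<close> has at least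
  \<open>5/2 * card S\<close> edges, of which at most \<open>card S\<close> are parent edges. This leaves a set \<open>F\<close> of
  \<open>\<lceil>3/2 * card S\<rceil>\<close> edges inside \<open>S\<close> whose removal does not change the ball.\<close>

lemma not_degenerate_imp_excess_edges:
  assumes "E \<subseteq> all_edges V" "finite V"
    and "\<not> degenerate 4 (r_ball r v \<lparr>verts = V, edges = E\<rparr>)"
  shows "\<exists>S F. S \<subseteq> V \<and> S \<subseteq> nball E r v \<and> 6 \<le> card S \<and> F \<subseteq> all_edges S \<and> F \<subseteq> E \<and>
           card F = (3 * card S + 1) div 2 \<and> nball (E - F) r v = nball E r v"
proof -
  obtain H where H: "is_subgraph H (r_ball r v \<lparr>verts = V, edges = E\<rparr>)" "verts H \<noteq> {}"
    "min_degree H > 4"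
    using assms(3) unfolding degenerate_def by (meson not_le)
  define S where "S = verts H"
  have wf: "wf_ugraph H" and SV: "S \<subseteq> V" and HE: "edges H \<subseteq> E"
    and SB: "S \<subseteq> nball E r v" and HS: "edges H \<subseteq> all_edges S"
    using H(1) graph_dist_le_imp_nball[of "\<lparr>verts = V, edges = E\<rparr>" v _ r]
    by (auto simp: is_subgraph_def r_ball_def induced_on_def wf_ugraph_def S_def)
  have fin: "finite S" "finite (edges H)"
    using finite_subset[OF SV] finite_subset[OF subset_trans[OF HE assms(1)]] assms(2)
    by (simp_all add: finite_all_edges)
  have deg: "5 \<le> degree H x" if "x \<in> S" for x
  proof -
    have "min_degree H \<le> degree H x" unfolding min_degree_def
      using that fin by (intro Min_le) (auto simp: S_def)
    with H(3) show ?thesis by simp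
  qed
  have "5 * card S \<le> (\<Sum>x\<in>S. degree H x)" using sum_mono[of S "\<lambda>_. 5" "degree H"] deg by simp
  then have E5: "5 * card S \<le> 2 * card (edges H)" using sum_degree[OF wf] by (simp add: S_def)
  also have "\<dots> \<le> 2 * (card S choose 2)"
    using card_mono[OF finite_all_edges[OF fin(1)] HS] card_all_edges[OF fin(1)] by simp
  also have "\<dots> \<le> card S * (card S - 1)" by (simp add: choose_two)
  \<comment> \<open>A graph on \<open>k > 0\<close> vertices has at most \<open>k * (k - 1) / 2\<close> edges, so \<open>5 \<le> k - 1\<close>.\<close>
  finally have "card S * 5 \<le> card S * (card S - 1)" by (simp only: mult.commute)
  moreover have "0 < card S" using H(2) fin by (auto simp: S_def card_gt_0_iff)
  ultimately have S6: "6 \<le> card S" by (simp add: mult_le_cancel1)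
  obtain T where T: "T \<subseteq> E" "\<forall>E'. T \<subseteq> E' \<and> E' \<subseteq> E \<longrightarrow> nball E' r v = nball E r v"
    "\<forall>S. finite S \<longrightarrow> card {e \<in> T. e \<subseteq> S} \<le> card S"
    using ex_parent_edges[of E r v] by blast
  have "edges H \<inter> T \<subseteq> {e \<in> T. e \<subseteq> S}" using HS by (auto simp: all_edges_def)
  then have "card (edges H \<inter> T) \<le> card {e \<in> T. e \<subseteq> S}"
    using finite_subset[OF subset_trans[OF T(1) assms(1)] finite_all_edges[OF assms(2)]]
    by (intro card_mono) simp_all
  also have "\<dots> \<le> card S" using T(3) fin(1) by blast
  finally have "card (edges H - T) + card S \<ge> card (edges H)"
    using card_Un_disjoint[of "edges H - T" "edges H \<inter> T"] fin
    by (simp add: Un_Diff_Int Int_assoc[symmetric] disjoint_iff)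
  then have "(3 * card S + 1) div 2 \<le> card (edges H - T)" using E5 by linarith
  then obtain F where F: "F \<subseteq> edges H - T" "card F = (3 * card S + 1) div 2"
    by (meson obtain_subset_with_card_n)
  moreover have "nball (E - F) r v = nball E r v"
    using F(1) T(1) by (intro T(2)[rule_format]) auto
  ultimately show ?thesis using SV SB S6 HS HE
    by (intro exI[of _ S] exI[of _ F] conjI) (simp_all, blast+)
qed

section \<open>Random subsets\<close>

text \<open>The random subset of \<open>A\<close> containing each element independently with probability \<open>p\<close>; for
  \<open>A = all_edges {..<n}\<close> it is the edge set of the random graph.\<close>

definition random_subset :: "'a set \<Rightarrow> real \<Rightarrow> 'a set pmf" where
  "random_subset A p =
     map_pmf (\<lambda>f. {e \<in> A. f e}) (Pi_pmf A False (\<lambda>_. bernoulli_pmf p))"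

lemma gnp_eq: "gnp n p =
    map_pmf (\<lambda>E. \<lparr>verts = {..<n}, edges = E\<rparr>) (random_subset (all_edges {..<n}) p)"
  by (simp add: gnp_def random_subset_def map_pmf_comp)

lemma set_random_subset: "set_pmf (random_subset A p) \<subseteq> Pow A"
  by (auto simp: random_subset_def)

lemma pmf_random_subset:
  assumes "finite A" "E \<subseteq> A" "0 < p" "p < 1"
  shows "pmf (random_subset A p) E = p ^ card E * (1 - p) ^ card (A - E)"
proof -
  let ?M = "Pi_pmf A False (\<lambda>_. bernoulli_pmf p)"
  have set: "set_pmf ?M = {f. \<forall>x. x \<notin> A \<longrightarrow> f x = False}"
    using assms by (auto simp: set_Pi_pmf PiE_dflt_def)
  have "inj_on (\<lambda>f. {e \<in> A. f e}) (set_pmf ?M)"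
    unfolding set by (auto simp: inj_on_def fun_eq_iff set_eq_iff)
  moreover have "(\<lambda>e. e \<in> E) \<in> set_pmf ?M" using assms set by auto
  ultimately have "pmf (random_subset A p) {e \<in> A. e \<in> E} = pmf ?M (\<lambda>e. e \<in> E)"
    unfolding random_subset_def using pmf_map_inj[of "\<lambda>f. {e \<in> A. f e}" ?M "\<lambda>e. e \<in> E"] by simp
  also have "\<dots> = (\<Prod>e\<in>A. if e \<in> E then p else 1 - p)"
    using assms by (subst pmf_Pi') (auto intro!: prod.cong)
  also have "\<dots> = p ^ card E * (1 - p) ^ card (A - E)"
    using assms by (subst prod.If_cases) (auto simp: Int_absorb1 Diff_eq)
  also have "{e \<in> A. e \<in> E} = E" using assms by auto
  finally show ?thesis .
qed

lemma prob_random_subset: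
  assumes "finite A"
  shows "measure_pmf.prob (random_subset A p) {E. P E} =
     (\<Sum>E | E \<subseteq> A \<and> P E. pmf (random_subset A p) E)"
proof -
  have "measure_pmf.prob (random_subset A p) {E. P E} =
      measure_pmf.prob (random_subset A p) {E. E \<subseteq> A \<and> P E}"
    by (rule measure_prob_cong_0) (use set_random_subset[of A p] in \<open>auto simp: set_pmf_iff\<close>)
  then show ?thesis using assms by (simp add: measure_measure_pmf_finite)
qed

lemma prob_random_subset_mono:
  assumes "\<And>E. E \<subseteq> A \<Longrightarrow> P E \<Longrightarrow> Q E"
  shows "measure_pmf.prob (random_subset A p) {E. P E}
    \<le> measure_pmf.prob (random_subset A p) {E. Q E}"
  using assms set_random_subset[of A p]
  by (intro measure_pmf.finite_measure_mono_AE) (auto simp: AE_measure_pmf_iff)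

text \<open>The map \<open>E \<mapsto> E - F\<close> is injective on the sets containing \<open>F\<close>, and the
  outcome \<open>E\<close> is \<open>(p / (1 - p)) ^ card F\<close> times as likely as \<open>E - F\<close>. This replaces conditioning
  on the outcome of an exploration of the graph.\<close>

lemma prob_remove:
  assumes "finite A" "F \<subseteq> A" "0 < p" "p < 1"
  shows "measure_pmf.prob (random_subset A p) {E. F \<subseteq> E \<and> Q (E - F)}
    \<le> (p / (1 - p)) ^ card F * measure_pmf.prob (random_subset A p) {E. Q E}"
proof -
  let ?w = "pmf (random_subset A p)" and ?X = "{E. E \<subseteq> A \<and> F \<subseteq> E \<and> Q (E - F)}"
  have fF: "finite F" using assms finite_subset by blast
  have w: "?w E = (p / (1 - p)) ^ card F * ?w (E - F)" if "E \<in> ?X" for E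
  proof -
    have E: "E \<subseteq> A" "F \<subseteq> E" "finite E" using that assms finite_subset by auto
    have "card E = card F + card (E - F)"
      using E fF by (simp add: card_Diff_subset card_mono)
    moreover have "A - (E - F) = F \<union> (A - E)" using E assms by auto
    then have "card (A - (E - F)) = card F + card (A - E)"
      using E fF assms by (simp add: card_Un_disjoint disjoint_iff subset_eq)
    ultimately show ?thesis using E assms
      by (simp add: pmf_random_subset power_add power_divide Diff_subset subset_trans[of "E - F" E A])
  qed
  have inj: "inj_on (\<lambda>E. E - F) ?X" by (auto simp: inj_on_def)
  have "measure_pmf.prob (random_subset A p) {E. F \<subseteq> E \<and> Q (E - F)} = (\<Sum>E\<in>?X. ?w E)"
    using assms by (simp add: prob_random_subset)
  also have "\<dots> = (p / (1 - p)) ^ card F * (\<Sum>E\<in>?X. ?w (E - F))"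
    by (simp add: w sum_distrib_left)
  also have "(\<Sum>E\<in>?X. ?w (E - F)) = (\<Sum>E\<in>(\<lambda>E. E - F) ` ?X. ?w E)"
    by (simp add: sum.reindex[OF inj] o_def)
  also have "\<dots> \<le> (\<Sum>E | E \<subseteq> A \<and> Q E. ?w E)"
    by (intro sum_mono2) (use assms in auto)
  also have "\<dots> = measure_pmf.prob (random_subset A p) {E. Q E}"
    using assms by (simp add: prob_random_subset)
  finally show ?thesis using assms by (simp add: mult_left_mono)
qed

text \<open>The expected number of indices \<open>i\<close> with \<open>P i\<close> is at most any bound \<open>c\<close> on their
  number that holds for every outcome.\<close>

lemma sum_prob_le_card:
  assumes "finite A" "finite I" "0 \<le> c"
    and "\<And>E. E \<subseteq> A \<Longrightarrow> real (card {i \<in> I. P i E}) \<le> c"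
  shows "(\<Sum>i\<in>I. measure_pmf.prob (random_subset A p) {E. P i E}) \<le> c"
proof -
  let ?w = "pmf (random_subset A p)"
  have "(\<Sum>i\<in>I. measure_pmf.prob (random_subset A p) {E. P i E})
      = (\<Sum>i\<in>I. \<Sum>E\<in>Pow A. if P i E then ?w E else 0)"
    using assms(1) by (intro sum.cong refl)
      (auto simp: prob_random_subset sum.If_cases Int_def intro!: sum.cong)
  also have "\<dots> = (\<Sum>E\<in>Pow A. \<Sum>i\<in>I. if P i E then ?w E else 0)" by (rule sum.swap)
  also have "\<dots> = (\<Sum>E\<in>Pow A. real (card {i \<in> I. P i E}) * ?w E)"
    using assms(2) by (intro sum.cong refl) (auto simp: sum.If_cases Int_def)
  also have "\<dots> \<le> (\<Sum>E\<in>Pow A. c * ?w E)"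
    by (intro sum_mono mult_right_mono) (use assms in auto)
  also have "\<dots> = c * measure_pmf.prob (random_subset A p) (Pow A)"
    using assms(1) by (simp add: measure_measure_pmf_finite sum_distrib_left)
  also have "\<dots> \<le> c" using assms(3) by (intro mult_left_le) auto
  finally show ?thesis .
qed

lemma prob_UN_le:
  assumes "finite I"
  shows "measure_pmf.prob M {x. \<exists>i\<in>I. P i x} \<le> (\<Sum>i\<in>I. measure_pmf.prob M {x. P i x})"
proof -
  have "{x. \<exists>i\<in>I. P i x} = (\<Union>i\<in>I. {x. P i x})" by auto
  then show ?thesis
    using measure_pmf.finite_measure_subadditive_finite[of I "\<lambda>i. {x. P i x}" M] assms by auto
qed

section \<open>Estimates for binomial coefficients\<close>

lemma power_div_fact_le_exp:
  assumes "0 \<le> (x::real)"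
  shows "x ^ m / fact m \<le> exp x"
proof -
  have "sum (\<lambda>k. x ^ k /\<^sub>R fact k) {m} \<le> (\<Sum>k. x ^ k /\<^sub>R fact k)"
    by (rule sum_le_suminf) (use assms summable_exp_generic[of x] in auto)
  then show ?thesis by (simp add: exp_def divide_inverse mult.commute)
qed

lemma binomial_times_power_le:
  assumes "0 \<le> (x::real)" "0 < m"
  shows "real (N choose m) * x ^ m \<le> (exp 1 * real N * x / real m) ^ m"
proof -
  have "real (N choose m) * fact m \<le> real N ^ m"
    using binomial_fact_pow[of N m] by (metis of_nat_fact of_nat_le_iff of_nat_mult of_nat_power)
  then have "real (N choose m) \<le> real N ^ m / fact m" by (simp add: field_simps)
  also have "\<dots> = (real N / real m) ^ m * (real m ^ m / fact m)"
    using assms by (simp add: power_divide)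
  also have "\<dots> \<le> (real N / real m) ^ m * exp (real m)"
    by (intro mult_left_mono power_div_fact_le_exp) auto
  also have "\<dots> = (exp 1 * real N / real m) ^ m"
    using exp_of_nat_mult[of m "1::real"] by (simp add: power_mult_distrib power_divide)
  finally have "real (N choose m) * x ^ m \<le> (exp 1 * real N / real m) ^ m * x ^ m"
    using assms by (intro mult_right_mono) auto
  then show ?thesis by (simp add: power_mult_distrib[symmetric])
qed

text \<open>The left-hand side counts pairs of a \<open>k\<close>-subset of an \<open>M\<close>-set and a set of
  \<open>\<lceil>3k/2\<rceil>\<close> pairs inside it, weighted with \<open>q\<close> for each pair. By the previous lemma it is at most
  \<open>((e M / k) * (e k q / 3) powr (3/2)) ^ k\<close>, and \<open>M * q \<le> 1/2\<close> turns this into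
  \<open>sqrt (7/5 * k * q) ^ k\<close>. Splitting off six of the \<open>k\<close> factors yields the power \<open>q ^ 3\<close>, and the
  remaining factors decay geometrically.\<close>

lemma excess_term_bound:
  fixes q :: real
  assumes "6 \<le> k" "k \<le> M" "0 \<le> q" "real M * q \<le> 1 / 2"
  shows "real (M choose k) * (real ((k choose 2) choose ((3 * k + 1) div 2)) * q ^ ((3 * k + 1) div 2))
     \<le> (7 / 5 * q) ^ 3 * (real k ^ 3 * sqrt (7 / 10) ^ (k - 6))"
proof -
  define m where "m = (3 * k + 1) div 2"
  define y where "y = exp 1 * real k * q / 3"
  define z where "z = 7 / 5 * real k * q"
  have m: "3 * k \<le> 2 * m" "0 < m" using assms(1) by (auto simp: m_def)
  have "real k * q \<le> real M * q" using assms by (intro mult_right_mono) auto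
  with assms(4) have kq: "real k * q \<le> 1 / 2" by simp
  have e: "exp 1 \<le> (272 / 100 :: real)" using e_less_272 by simp
  have "exp 1 * (real k * q) \<le> 272 / 100 * (1 / 2)"
    using e kq assms(3) by (intro mult_mono) auto
  then have y: "0 \<le> y" "y \<le> 1" using assms(3) by (auto simp: y_def)
  have "z = 7 / 5 * (real k * q)" by (simp add: z_def)
  then have z: "0 \<le> z" "z \<le> 7 / 10" using kq assms(3) by (simp_all only:) auto
  have 1: "real (M choose k) \<le> (exp 1 * real M / real k) ^ k"
    using binomial_times_power_le[of 1 k M] assms(1) by simp
  have "real ((k choose 2) choose m) * q ^ m \<le> (exp 1 * real (k choose 2) * q / real m) ^ m"
    using m assms by (intro binomial_times_power_le) auto
  also have "\<dots> \<le> y ^ m"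
  proof (rule power_mono)
    have "2 * (k choose 2) \<le> k * (k - 1)" by (simp add: choose_two)
    also have "\<dots> \<le> k * k" by simp
    finally have "real (2 * (k choose 2)) \<le> real (k * k)" by (simp only: of_nat_le_iff)
    then have "real (k choose 2) \<le> real k * real k / 2" by simp
    also have "\<dots> \<le> real k / 3 * real m"
    proof -
      have "real k * (3 * real k) \<le> real k * (2 * real m)"
        using m(1) by (intro mult_left_mono) linarith+
      then show ?thesis by simp
    qed
    finally have "real (k choose 2) / real m \<le> real k / 3" using m(2) by (simp add: divide_le_eq)
    then have "exp 1 * q * (real (k choose 2) / real m) \<le> exp 1 * q * (real k / 3)"
      using assms(3) by (intro mult_left_mono) auto
    then show "exp 1 * real (k choose 2) * q / real m \<le> y" by (simp add: y_def mult_ac)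
  qed (use assms in auto)
  \<comment> \<open>Since \<open>y \<le> 1\<close> and \<open>m \<ge> 3k/2\<close>, the exponent can be lowered to \<open>3k/2\<close>, written with a square root.\<close>
  also have "y ^ m = sqrt y ^ (2 * m)" using y by (simp add: power_mult)
  also have "\<dots> \<le> sqrt y ^ (3 * k)" using m y by (intro power_decreasing) auto
  finally have 2: "real ((k choose 2) choose m) * q ^ m \<le> (sqrt y ^ 3) ^ k"
    by (simp add: power_mult)
  have 3: "exp 1 * real M / real k * sqrt y ^ 3 \<le> sqrt z"
  proof (rule real_le_rsqrt)
    have "(sqrt y ^ 3)\<^sup>2 = y ^ 3" using y by (metis power_mult mult.commute real_sqrt_pow2)
    then have "(exp 1 * real M / real k * sqrt y ^ 3)\<^sup>2 = (exp 1 * real M / real k)\<^sup>2 * y ^ 3"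
      by (simp only: power_mult_distrib)
    also have "\<dots> = exp 1 ^ 5 * (real M * q)\<^sup>2 * (real k * q) / 27"
      using assms(1) by (simp add: y_def field_simps power2_eq_square power3_eq_cube eval_nat_numeral)
    \<comment> \<open>The bound \<open>e < 2.72\<close> gives \<open>e ^ 5 / 108 \<le> 7/5\<close>.\<close>
    also have "\<dots> \<le> (272 / 100) ^ 5 * (1 / 2)\<^sup>2 * (real k * q) / 27"
      using e assms by (intro divide_right_mono mult_mono power_mono) auto
    also have "\<dots> \<le> z"
    proof -
      have "(272 / 100) ^ 5 * (1 / 2)\<^sup>2 / 27 * (real k * q) \<le> 7 / 5 * (real k * q)"
        using assms by (intro mult_right_mono) (auto simp: power2_eq_square eval_nat_numeral)
      then show ?thesis by (simp add: z_def)
    qed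
    finally show "(exp 1 * real M / real k * sqrt y ^ 3)\<^sup>2 \<le> z" .
  qed
  have "real (M choose k) * (real ((k choose 2) choose m) * q ^ m)
      \<le> (exp 1 * real M / real k) ^ k * (sqrt y ^ 3) ^ k"
    using 1 2 assms by (intro mult_mono) auto
  also have "\<dots> = (exp 1 * real M / real k * sqrt y ^ 3) ^ k" by (simp only: power_mult_distrib)
  also have "\<dots> \<le> sqrt z ^ k" using 3 y by (intro power_mono) auto
  also have "\<dots> = sqrt z ^ (2 * 3 + (k - 6))" using assms(1) by simp
  also have "\<dots> = z ^ 3 * sqrt z ^ (k - 6)"
    using z by (simp only: power_add power_mult) simp
  also have "\<dots> \<le> z ^ 3 * sqrt (7 / 10) ^ (k - 6)"
    using z by (intro mult_left_mono power_mono) auto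
  also have "\<dots> = (7 / 5 * q) ^ 3 * (real k ^ 3 * sqrt (7 / 10) ^ (k - 6))"
    unfolding z_def power_mult_distrib by (simp only: mult_ac)
  finally show ?thesis by (simp only: m_def)
qed

text \<open>The constant obtained by summing the bounds of the previous lemma over all \<open>k = j + 6\<close>; only
  its finiteness matters.\<close>

definition excess_const :: real where
  "excess_const = (7 / 5) ^ 3 * (\<Sum>j. real (j + 6) ^ 3 * sqrt (7 / 10) ^ j)"

lemma summable_excess: "summable (\<lambda>j. real (j + 6) ^ 3 * sqrt (7 / 10) ^ j)"
proof (rule summable_comparison_test_bigo)
  show "summable (\<lambda>n. norm (1 / real n ^ 2))"
    using inverse_power_summable[of 2, where 'a = real] by (simp add: inverse_eq_divide)
  show "(\<lambda>j. real (j + 6) ^ 3 * sqrt (7 / 10) ^ j) \<in> O(\<lambda>n. 1 / real n ^ 2)"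
    by real_asymp
qed

lemma excess_sum_bound:
  fixes q :: real
  assumes "0 \<le> q" "real M * q \<le> 1 / 2"
  shows "(\<Sum>k=6..M. real (M choose k) *
       (real ((k choose 2) choose ((3 * k + 1) div 2)) * q ^ ((3 * k + 1) div 2)))
     \<le> excess_const * q ^ 3"
proof -
  let ?g = "\<lambda>j. real (j + 6) ^ 3 * sqrt (7 / 10) ^ j"
  have "(\<Sum>k=6..M. real (M choose k) *
       (real ((k choose 2) choose ((3 * k + 1) div 2)) * q ^ ((3 * k + 1) div 2)))
      \<le> (\<Sum>k=6..M. (7 / 5 * q) ^ 3 * ?g (k - 6))"
  proof (rule sum_mono)
    fix k assume "k \<in> {6..M}"
    then show "real (M choose k) *
       (real ((k choose 2) choose ((3 * k + 1) div 2)) * q ^ ((3 * k + 1) div 2))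
       \<le> (7 / 5 * q) ^ 3 * ?g (k - 6)"
      using excess_term_bound[of k M q] assms by simp
  qed
  also have "\<dots> = (7 / 5 * q) ^ 3 * (\<Sum>k=6..M. ?g (k - 6))" by (simp only: sum_distrib_left)
  also have "(\<Sum>k=6..M. ?g (k - 6)) = sum ?g ((\<lambda>k. k - 6) ` {6..M})"
    by (subst sum.reindex) (auto simp: inj_on_def)
  also have "\<dots> \<le> suminf ?g" by (intro sum_le_suminf summable_excess) auto
  also have "(7 / 5 * q) ^ 3 * suminf ?g = excess_const * q ^ 3"
    unfolding excess_const_def power_mult_distrib by (simp only: mult_ac)
  finally show ?thesis using assms(1) by (simp add: mult_left_mono)
qed

section \<open>The union bounds\<close>

lemma prob_degree_ge:
  assumes "finite V" "x \<in> V" "0 < p" "p < 1" "0 < D"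
  shows "measure_pmf.prob (random_subset (all_edges V) p) {E. D \<le> card {u. {x, u} \<in> E}}
      \<le> (exp 1 * real (card V) * (p / (1 - p)) / real D) ^ D"
proof -
  let ?P = "measure_pmf.prob (random_subset (all_edges V) p)" and ?q = "p / (1 - p)"
  define star where "star = (\<lambda>u. {x, u}) ` (V - {x})"
  define I where "I = {F. F \<subseteq> star \<and> card F = D}"
  have fin: "finite star" "finite I" using assms by (auto simp: star_def I_def)
  have "card star \<le> card (V - {x})" unfolding star_def using assms(1) by (intro card_image_le) simp
  also have "\<dots> \<le> card V" using assms(1) by (intro card_mono) auto
  finally have "card star \<le> card V" .
  then have I: "card I \<le> card V choose D"
    using n_subsets[OF fin(1), of D] by (simp add: I_def binomial_right_mono)
  have "?P {E. D \<le> card {u. {x, u} \<in> E}} \<le> ?P {E. \<exists>F\<in>I. F \<subseteq> E \<and> True}"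
  proof (rule prob_random_subset_mono)
    fix E assume E: "E \<subseteq> all_edges V" "D \<le> card {u. {x, u} \<in> E}"
    have "inj_on (\<lambda>u. {x, u}) {u. {x, u} \<in> E}" by (auto simp: inj_on_def doubleton_eq_iff)
    then have "D \<le> card ((\<lambda>u. {x, u}) ` {u. {x, u} \<in> E})" using E(2) by (simp only: card_image)
    then obtain F where F: "F \<subseteq> (\<lambda>u. {x, u}) ` {u. {x, u} \<in> E}" "card F = D"
      by (meson obtain_subset_with_card_n)
    have "(\<lambda>u. {x, u}) ` {u. {x, u} \<in> E} \<subseteq> E" by (rule image_subsetI) simp
    with F(1) have "F \<subseteq> E" by (rule subset_trans)
    have "(\<lambda>u. {x, u}) ` {u. {x, u} \<in> E} \<subseteq> star"
    proof (rule image_subsetI)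
      fix u assume "u \<in> {u. {x, u} \<in> E}"
      then have "{x, u} \<subseteq> V" "card {x, u} = 2" using E(1) by (auto simp: all_edges_def)
      then have "u \<in> V - {x}" by auto
      then show "{x, u} \<in> star" unfolding star_def by (rule imageI)
    qed
    with F(1) have "F \<subseteq> star" by (rule subset_trans)
    with F(2) \<open>F \<subseteq> E\<close> show "\<exists>F\<in>I. F \<subseteq> E \<and> True" by (auto simp: I_def)
  qed
  also have "\<dots> \<le> (\<Sum>F\<in>I. ?P {E. F \<subseteq> E \<and> True})" using fin(2) by (rule prob_UN_le)
  also have "\<dots> \<le> (\<Sum>F\<in>I. ?q ^ D)"
  proof (rule sum_mono)
    fix F assume F: "F \<in> I"
    have "star \<subseteq> all_edges V" using assms(2) by (auto simp: star_def all_edges_def card_insert_if)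
    with F have "F \<subseteq> all_edges V" by (auto simp: I_def)
    then show "?P {E. F \<subseteq> E \<and> True} \<le> ?q ^ D"
      using prob_remove[of "all_edges V" F p "\<lambda>_. True"] F assms finite_all_edges[of V]
      by (simp add: I_def)
  qed
  also have "\<dots> \<le> real (card V choose D) * ?q ^ D"
    using I assms by (simp add: mult_right_mono)
  also have "\<dots> \<le> (exp 1 * real (card V) * ?q / real D) ^ D"
    using assms by (intro binomial_times_power_le) auto
  finally show ?thesis .
qed

text \<open>The union bound over \<open>S\<close> and \<open>F\<close>. The event \<open>Q S\<close>, that \<open>S\<close> lies in a small ball, survives
  the removal of \<open>F\<close>, so each \<open>F\<close> costs a factor \<open>q ^ card F\<close>; and on average at most
  \<open>M choose k\<close> sets \<open>S\<close> of size \<open>k\<close> satisfy \<open>Q S\<close>.\<close>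

lemma prob_ball_not_degenerate:
  assumes "finite V" "v \<in> V" "0 < p" "p < 1" "real M * (p / (1 - p)) \<le> 1 / 2"
  shows "measure_pmf.prob (random_subset (all_edges V) p)
      {E. card (nball E r v) \<le> M \<and> \<not> degenerate 4 (r_ball r v \<lparr>verts = V, edges = E\<rparr>)}
    \<le> excess_const * (p / (1 - p)) ^ 3"
proof -
  let ?P = "measure_pmf.prob (random_subset (all_edges V) p)"
  define q where "q = p / (1 - p)"
  define m where "m k = (3 * k + 1) div 2" for k :: nat
  define \<S> where "\<S> k = {S. S \<subseteq> V \<and> card S = k}" for k
  define \<F> where "\<F> S = {F. F \<subseteq> all_edges S \<and> card F = m (card S)}" for S :: "'a set"
  define Q where "Q S E \<longleftrightarrow> S \<subseteq> nball E r v \<and> card (nball E r v) \<le> M" for S E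
  have q: "0 \<le> q" using assms by (simp add: q_def)
  have finA: "finite (all_edges V)" using assms(1) by (rule finite_all_edges)
  have finS: "finite (\<S> k)" for k using assms(1) by (simp add: \<S>_def)
  have finF: "finite (\<F> S)" if "S \<in> \<S> k" for S k
    using that assms(1) finite_all_edges[of S] finite_subset[of S V] by (auto simp: \<S>_def \<F>_def)
  have "?P {E. card (nball E r v) \<le> M \<and> \<not> degenerate 4 (r_ball r v \<lparr>verts = V, edges = E\<rparr>)}
      \<le> ?P {E. \<exists>k\<in>{6..M}. \<exists>S\<in>\<S> k. \<exists>F\<in>\<F> S. F \<subseteq> E \<and> Q S (E - F)}"
  proof (rule prob_random_subset_mono, elim conjE)
    fix E assume E: "E \<subseteq> all_edges V" "card (nball E r v) \<le> M"
      "\<not> degenerate 4 (r_ball r v \<lparr>verts = V, edges = E\<rparr>)"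
    then obtain S F where SF: "S \<subseteq> V" "S \<subseteq> nball E r v" "6 \<le> card S" "F \<subseteq> all_edges S" "F \<subseteq> E"
      "card F = m (card S)" "nball (E - F) r v = nball E r v"
      using not_degenerate_imp_excess_edges[OF E(1) assms(1) E(3)] unfolding m_def by auto
    have "finite (nball E r v)"
      using nball_subset_verts[OF E(1) assms(2)] assms(1) finite_subset by blast
    from card_mono[OF this SF(2)] have "card S \<le> M" using E(2) by simp
    then show "\<exists>k\<in>{6..M}. \<exists>S\<in>\<S> k. \<exists>F\<in>\<F> S. F \<subseteq> E \<and> Q S (E - F)"
      using SF E(2)
      by (intro bexI[of _ "card S"] bexI[of _ S] bexI[of _ F]) (simp_all add: \<S>_def \<F>_def Q_def)
  qed
  also have "\<dots> \<le> (\<Sum>k=6..M. ?P {E. \<exists>S\<in>\<S> k. \<exists>F\<in>\<F> S. F \<subseteq> E \<and> Q S (E - F)})"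
    by (rule prob_UN_le) simp
  also have "\<dots> \<le> (\<Sum>k=6..M. real (M choose k) * (real ((k choose 2) choose m k) * q ^ m k))"
  proof (rule sum_mono)
    fix k
    have "?P {E. \<exists>S\<in>\<S> k. \<exists>F\<in>\<F> S. F \<subseteq> E \<and> Q S (E - F)}
        \<le> (\<Sum>S\<in>\<S> k. ?P {E. \<exists>F\<in>\<F> S. F \<subseteq> E \<and> Q S (E - F)})"
      using finS by (rule prob_UN_le)
    also have "\<dots> \<le> (\<Sum>S\<in>\<S> k. (real ((k choose 2) choose m k) * q ^ m k) * ?P {E. Q S E})"
    proof (rule sum_mono)
      fix S assume S: "S \<in> \<S> k"
      then have fS: "finite S" using assms(1) by (auto simp: \<S>_def intro: finite_subset)
      have "?P {E. \<exists>F\<in>\<F> S. F \<subseteq> E \<and> Q S (E - F)} \<le> (\<Sum>F\<in>\<F> S. ?P {E. F \<subseteq> E \<and> Q S (E - F)})"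
        using finF[OF S] by (rule prob_UN_le)
      also have "\<dots> \<le> (\<Sum>F\<in>\<F> S. q ^ m k * ?P {E. Q S E})"
      proof (rule sum_mono)
        fix F assume F: "F \<in> \<F> S"
        then have "F \<subseteq> all_edges V" using S by (auto simp: \<F>_def \<S>_def all_edges_def)
        then show "?P {E. F \<subseteq> E \<and> Q S (E - F)} \<le> q ^ m k * ?P {E. Q S E}"
          using prob_remove[OF finA, of F p "Q S"] assms(3,4) F S by (simp add: \<F>_def \<S>_def q_def)
      qed
      also have "\<dots> = (real ((k choose 2) choose m k) * q ^ m k) * ?P {E. Q S E}"
        using n_subsets[OF finite_all_edges[OF fS], of "m k"] card_all_edges[OF fS] S
        by (simp add: \<F>_def \<S>_def)
      finally show "?P {E. \<exists>F\<in>\<F> S. F \<subseteq> E \<and> Q S (E - F)}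
        \<le> (real ((k choose 2) choose m k) * q ^ m k) * ?P {E. Q S E}" .
    qed
    also have "\<dots> = (real ((k choose 2) choose m k) * q ^ m k) * (\<Sum>S\<in>\<S> k. ?P {E. Q S E})"
      by (rule sum_distrib_left[symmetric])
    also have "\<dots> \<le> (real ((k choose 2) choose m k) * q ^ m k) * real (M choose k)"
    proof (rule mult_left_mono)
      show "(\<Sum>S\<in>\<S> k. ?P {E. Q S E}) \<le> real (M choose k)"
      proof (rule sum_prob_le_card[OF finA finS])
        fix E assume E: "E \<subseteq> all_edges V"
        have fin: "finite (nball E r v)"
          using nball_subset_verts[OF E assms(2)] assms(1) finite_subset by blast
        show "real (card {S \<in> \<S> k. Q S E}) \<le> real (M choose k)"
        proof (cases "card (nball E r v) \<le> M")
          case True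
          have "card {S \<in> \<S> k. Q S E} \<le> card {S. S \<subseteq> nball E r v \<and> card S = k}"
            by (intro card_mono) (use fin in \<open>auto simp: \<S>_def Q_def\<close>)
          also have "\<dots> = card (nball E r v) choose k" by (rule n_subsets[OF fin])
          also have "\<dots> \<le> M choose k" using True by (rule binomial_right_mono)
          finally show ?thesis by simp
        qed (simp add: Q_def)
      qed simp
    qed (use q in auto)
    finally show "?P {E. \<exists>S\<in>\<S> k. \<exists>F\<in>\<F> S. F \<subseteq> E \<and> Q S (E - F)}
        \<le> real (M choose k) * (real ((k choose 2) choose m k) * q ^ m k)" by (simp only: mult_ac)
  qed
  also have "\<dots> \<le> excess_const * q ^ 3"
    unfolding m_def using excess_sum_bound[OF q] assms(5) by (simp add: q_def)
  finally show ?thesis by (simp add: q_def)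
qed

lemma prob_not_degenerate:
  assumes "finite V" "0 < p" "p < 1" "(\<Sum>j\<le>r. real \<Delta> ^ j) * (p / (1 - p)) \<le> 1 / 2"
  shows "measure_pmf.prob (random_subset (all_edges V) p)
      {E. \<exists>v\<in>V. \<not> degenerate 4 (r_ball r v \<lparr>verts = V, edges = E\<rparr>)}
    \<le> real (card V) * (exp 1 * real (card V) * (p / (1 - p)) / real (Suc \<Delta>)) ^ Suc \<Delta>
      + real (card V) * (excess_const * (p / (1 - p)) ^ 3)"
proof -
  let ?P = "measure_pmf.prob (random_subset (all_edges V) p)"
  let ?deg = "\<lambda>x E. card {u. {x, u} \<in> E}"
  let ?bad = "\<lambda>v E. \<not> degenerate 4 (r_ball r v \<lparr>verts = V, edges = E\<rparr>)"
  define M where "M = (\<Sum>j\<le>r. \<Delta> ^ j)"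
  have M: "real M * (p / (1 - p)) \<le> 1 / 2" using assms(4) by (simp add: M_def)
  \<comment> \<open>Either some degree exceeds \<open>\<Delta>\<close>, or every ball has at most \<open>M\<close> vertices.\<close>
  have "?P {E. \<exists>v\<in>V. ?bad v E}
     \<le> ?P {E. \<exists>v\<in>V. Suc \<Delta> \<le> ?deg v E \<or> card (nball E r v) \<le> M \<and> ?bad v E}"
  proof (rule prob_random_subset_mono)
    fix E assume E: "E \<subseteq> all_edges V" "\<exists>v\<in>V. ?bad v E"
    show "\<exists>v\<in>V. Suc \<Delta> \<le> ?deg v E \<or> card (nball E r v) \<le> M \<and> ?bad v E"
    proof (cases "\<exists>v\<in>V. Suc \<Delta> \<le> ?deg v E")
      case False
      then show ?thesis
        using E card_nball_le[OF assms(1) E(1), of _ \<Delta> r] unfolding M_def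
        by (metis not_less_eq_eq)
    qed auto
  qed
  also have "\<dots> \<le> (\<Sum>v\<in>V. ?P {E. Suc \<Delta> \<le> ?deg v E \<or> card (nball E r v) \<le> M \<and> ?bad v E})"
    using assms(1) by (rule prob_UN_le)
  also have "\<dots> \<le> (\<Sum>v\<in>V. (exp 1 * real (card V) * (p / (1 - p)) / real (Suc \<Delta>)) ^ Suc \<Delta>
      + excess_const * (p / (1 - p)) ^ 3)"
  proof (rule sum_mono)
    fix v assume v: "v \<in> V"
    have "{E. Suc \<Delta> \<le> ?deg v E \<or> card (nball E r v) \<le> M \<and> ?bad v E}
        = {E. Suc \<Delta> \<le> ?deg v E} \<union> {E. card (nball E r v) \<le> M \<and> ?bad v E}" by auto
    then have "?P {E. Suc \<Delta> \<le> ?deg v E \<or> card (nball E r v) \<le> M \<and> ?bad v E}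
       \<le> ?P {E. Suc \<Delta> \<le> ?deg v E} + ?P {E. card (nball E r v) \<le> M \<and> ?bad v E}"
      by (simp add: measure_Un_le)
    also have "\<dots> \<le> (exp 1 * real (card V) * (p / (1 - p)) / real (Suc \<Delta>)) ^ Suc \<Delta>
      + excess_const * (p / (1 - p)) ^ 3"
      using assms v M by (intro add_mono prob_degree_ge prob_ball_not_degenerate) auto
    finally show "?P {E. Suc \<Delta> \<le> ?deg v E \<or> card (nball E r v) \<le> M \<and> ?bad v E} \<le> \<dots>" .
  qed
  also have "\<dots> = real (card V) * (exp 1 * real (card V) * (p / (1 - p)) / real (Suc \<Delta>)) ^ Suc \<Delta>
      + real (card V) * (excess_const * (p / (1 - p)) ^ 3)" by (simp add: distrib_left)
  finally show ?thesis .
qed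

section \<open>The limit\<close>

lemma sum_powers_le:
  fixes d :: real
  assumes "10 / 3 \<le> d"
  shows "(\<Sum>j\<le>r. d ^ j) \<le> 10 / 7 * d ^ r"
proof (induction r)
  case (Suc r)
  have "10 / 3 * d ^ r \<le> d * d ^ r" using assms by (intro mult_right_mono) auto
  with Suc show ?case by simp
qed simp

text \<open>With the degree bound \<open>\<Delta> = \<lfloor>d\<rfloor>\<close>, balls have at most \<open>10/7 * d ^ r\<close> vertices and
  \<open>q \<le> 7/20 * d ^ (-r)\<close>, whose product is exactly the \<open>1/2\<close> that \<open>prob_not_degenerate\<close>
  permits. The base of the degree
  estimate is \<open>7/20 * e < 119/125 < 1\<close>, and \<open>n * q ^ 3 \<le> d ^ (1 - 2 * r) \<le> 1 / d\<close>.\<close>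

lemma prob_gnp_bad_le:
  fixes d p :: real
  assumes "0 < r" "4 \<le> d" "n = nat \<lfloor>d ^ (r + 1)\<rfloor>" "p = 3 / 10 * d powi (- int r)"
  shows "1 - measure_pmf.prob (gnp n p) {G. \<forall>v\<in>verts G. degenerate 4 (r_ball r v G)}
    \<le> d ^ (r + 1) * (119 / 125) powr d + excess_const * (1 / d)"
proof -
  define q where "q = p / (1 - p)"
  define \<Delta> where "\<Delta> = nat \<lfloor>d\<rfloor>"
  have d0: "0 < d" using assms(2) by simp
  have p: "p = 3 / 10 / d ^ r" using assms(4) by (simp add: power_int_minus field_simps)
  have d_le: "d \<le> d ^ r" using assms(1,2) power_increasing[of 1 r d] by simp
  then have d4: "4 \<le> d ^ r" using assms(2) by simp
  then have "0 < p" "p \<le> 1 / 7" using p by (auto simp: field_simps)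
  have q0: "0 \<le> q" using \<open>0 < p\<close> \<open>p \<le> 1 / 7\<close> by (simp add: q_def)
  have "q \<le> p / (6 / 7)" unfolding q_def
    using \<open>0 < p\<close> \<open>p \<le> 1 / 7\<close> by (intro divide_left_mono) auto
  also have "\<dots> = 7 / 20 / d ^ r" by (simp add: p)
  finally have q: "q \<le> 7 / 20 / d ^ r" .
  have n: "real n \<le> d ^ (r + 1)" using assms(2,3) by simp
  have \<Delta>: "real \<Delta> \<le> d" "d \<le> real (Suc \<Delta>)" unfolding \<Delta>_def using d0 by linarith+
  have const: "0 \<le> excess_const" unfolding excess_const_def
    by (intro mult_nonneg_nonneg suminf_nonneg summable_excess) auto
  have "(\<Sum>j\<le>r. real \<Delta> ^ j) \<le> (\<Sum>j\<le>r. d ^ j)"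
    using \<Delta>(1) by (intro sum_mono power_mono) auto
  also have "\<dots> \<le> 10 / 7 * d ^ r" using assms(2) by (intro sum_powers_le) auto
  finally have "(\<Sum>j\<le>r. real \<Delta> ^ j) * q \<le> 10 / 7 * d ^ r * (7 / 20 / d ^ r)"
    using q q0 d0 by (intro mult_mono) auto
  then have ball: "(\<Sum>j\<le>r. real \<Delta> ^ j) * q \<le> 1 / 2" using d0 by simp
  have "1 - measure_pmf.prob (gnp n p) {G. \<forall>v\<in>verts G. degenerate 4 (r_ball r v G)}
      = measure_pmf.prob (gnp n p) (- {G. \<forall>v\<in>verts G. degenerate 4 (r_ball r v G)})"
    using measure_pmf.prob_compl[of "{G. \<forall>v\<in>verts G. degenerate 4 (r_ball r v G)}" "gnp n p"]
    by (simp add: Compl_eq_Diff_UNIV)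
  also have "\<dots> = measure_pmf.prob (random_subset (all_edges {..<n}) p)
      {E. \<exists>v\<in>{..<n}. \<not> degenerate 4 (r_ball r v \<lparr>verts = {..<n}, edges = E\<rparr>)}"
    by (simp add: gnp_eq vimage_def Compl_eq)
  also have "\<dots> \<le> real n * (exp 1 * real n * q / real (Suc \<Delta>)) ^ Suc \<Delta>
      + real n * (excess_const * q ^ 3)"
    using prob_not_degenerate[of "{..<n}" p \<Delta> r] ball \<open>0 < p\<close> \<open>p \<le> 1 / 7\<close> by (simp add: q_def)
  also have "\<dots> \<le> d ^ (r + 1) * (119 / 125) powr d + excess_const * (1 / d)"
  proof (rule add_mono)
    have "exp 1 * real n * q / real (Suc \<Delta>) \<le> 272 / 100 * d ^ (r + 1) * (7 / 20 / d ^ r) / d"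
      using e_less_272 n q q0 d0 \<Delta> by (intro frac_le mult_mono) auto
    also have "\<dots> = 119 / 125" using d0 by simp
    finally have "(exp 1 * real n * q / real (Suc \<Delta>)) ^ Suc \<Delta> \<le> (119 / 125) ^ Suc \<Delta>"
      using q0 by (intro power_mono) auto
    also have "\<dots> = (119 / 125) powr real (Suc \<Delta>)" by (subst powr_realpow) auto
    also have "\<dots> \<le> (119 / 125) powr d" using \<Delta>(2) by (intro powr_mono') auto
    finally show "real n * (exp 1 * real n * q / real (Suc \<Delta>)) ^ Suc \<Delta>
        \<le> d ^ (r + 1) * (119 / 125) powr d"
      using n q0 by (intro mult_mono) auto
  next
    have "real n * q ^ 3 \<le> d ^ (r + 1) * (1 / d ^ r) ^ 3"
    proof (intro mult_mono power_mono)
      show "q \<le> 1 / d ^ r" using d0 by (intro order_trans[OF q] divide_right_mono) auto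
    qed (use n q0 d0 in auto)
    also have "\<dots> = d / (d ^ r * d ^ r)" using d0 by (simp add: power_divide power3_eq_cube)
    also have "\<dots> \<le> d / (d * d)"
    proof -
      have "d * d \<le> d ^ r * d ^ r" using d_le d0 by (intro mult_mono) auto
      then show ?thesis using d0 by (intro divide_left_mono) auto
    qed
    finally have "real n * q ^ 3 \<le> 1 / d" using d0 by simp
    then have "excess_const * (real n * q ^ 3) \<le> excess_const * (1 / d)"
      using const by (rule mult_left_mono)
    then show "real n * (excess_const * q ^ 3) \<le> excess_const * (1 / d)" by (simp only: mult_ac)
  qed
  finally show ?thesis .
qed

theorem theorem3p5:
  fixes r :: nat and n :: "nat \<Rightarrow> nat" and p :: "nat \<Rightarrow> real"
  assumes "r > 0"
    and "\<And>l. n l = nat \<lfloor>(10 * real l * ln (real l)) ^ (r + 1)\<rfloor>"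
    and "\<And>l. p l = 3 / 10 * (10 * real l * ln (real l)) powi (- int r)"
  shows "(\<lambda>l. measure_pmf.prob (gnp (n l) (p l))
            {G. \<forall>v \<in> verts G. degenerate 4 (r_ball r v G)}) \<longlonglongrightarrow> 1"
proof -
  let ?d = "\<lambda>l. 10 * real l * ln (real l)"
  let ?P = "\<lambda>l. measure_pmf.prob (gnp (n l) (p l)) {G. \<forall>v \<in> verts G. degenerate 4 (r_ball r v G)}"
  let ?f = "\<lambda>d. d ^ (r + 1) * (119 / 125 :: real) powr d + excess_const * (1 / d)"
  have d: "filterlim ?d at_top sequentially" by real_asymp
  have "((\<lambda>d. d ^ (r + 1) * (119 / 125 :: real) powr d) \<longlongrightarrow> 0) at_top" by real_asymp
  moreover have "((\<lambda>d. excess_const * (1 / d)) \<longlongrightarrow> 0) at_top" by real_asymp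
  ultimately have "(?f \<longlongrightarrow> 0) at_top" using tendsto_add_zero by blast
  then have f: "(\<lambda>l. ?f (?d l)) \<longlonglongrightarrow> 0" using d by (rule filterlim_compose)
  have "eventually (\<lambda>l. 1 - ?P l \<le> ?f (?d l)) sequentially"
    using filterlim_at_top_dense[THEN iffD1, OF d, rule_format, of 4]
  proof (rule eventually_mono)
    fix l assume "4 < ?d l"
    then show "1 - ?P l \<le> ?f (?d l)"
      by (intro prob_gnp_bad_le[OF assms(1) less_imp_le assms(2,3)])
  qed
  then have "(\<lambda>l. 1 - ?P l) \<longlonglongrightarrow> 0"
    by (intro tendsto_sandwich[OF _ _ tendsto_const f]) (auto simp: measure_pmf.prob_le_1)
  from tendsto_diff[OF tendsto_const[of 1] this] show ?thesis by simp
qed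

end
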